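(* Let $K \in \mathbb{R}^{m\times n}$ and let $0<\gamma\le 1$ satisfy $\sqrt{\gamma}\,\rho(A-BK)<1$. Then, for $\gamma'>0$, $J_{\gamma'}(K)<+\infty$ if $$\gamma' \leq \left(1 + \frac{\underline{\sigma}(Q+K^{\top}RK)}{J_{\gamma}(K) - \underline{\sigma}(Q+K^{\top}RK)}\right)\gamma .$$
   Context: Consider the discrete-time linear system $x_{t+1}=Ax_t+Bu_t$, $x_0\sim\mathcal{D}$, with $x_t\in\mathbb{R}^n$, $u_t\in\mathbb{R}^m$, $A\in\mathbb{R}^{n\times n}$, $B\in\mathbb{R}^{n\times m}$. Standing assumptions: the distribution $\mathcal{D}$ has zero mean and identity covariance, $\mathbb{E}[x_0x_0^\top]=I$, and its support is bounded, $\|x_0\|\le d$ for a constant $d>0$; the pair $(A,B)$ is stabilizable. The matrices $Q\in\mathbb{R}^{n\times n}$ and $R\in\mathbb{R}^{m\times m}$ are given symmetric positive definite matrices. $\rho(\cdot)$ is the spectral radius and $\underline{\sigma}(\cdot)$ is the minimal eigenvalue of a matrix. For a gain $K\in\mathbb{R}^{m\times n}$ and a discount factor $\gamma$, the discounted LQR cost is $$J_\gamma(K)=\mathbb{E}_{x_0}\sum_{t=0}^{\infty}\gamma^t\,(x_t^\top Qx_t+u_t^\top Ru_t)\in[0,+\infty],$$ where $x_{t+1}=Ax_t+Bu_t$ and $u_t=-Kx_t$. The same formula is used to define $J_{\gamma'}(K)$.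
   Formalization: For n = 1 the bound on γ' is required to be strict: with equality and A−BK ≠ 0 the bound equals 1/(A−BK)² and J_{γ'}(K) = +∞, so the printed claim fails there; if J_γ(K) equals the minimal eigenvalue, the bound is read as +∞. *)

theory Defs
  imports "HOL-Probability.Probability"
begin

definition eigenvalues :: "'a::field^'n^'n \<Rightarrow> 'a set" where
  "eigenvalues M = {c. \<exists>v. v \<noteq> 0 \<and> M *v v = c *s v}"

(* All complex eigenvalues of the real matrix are taken into account. *)
definition spectral_radius :: "real^'n^'n \<Rightarrow> real" where
  "spectral_radius M = Max (cmod ` eigenvalues (\<chi> i j. complex_of_real (M $ i $ j)))"

(* Only real eigenvalues are considered: meant for symmetric matrices. *)
definition min_eigenvalue :: "real^'n^'n \<Rightarrow> real" where
  "min_eigenvalue M = Min (eigenvalues M)"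

definition sym_pos_def :: "real^'n^'n \<Rightarrow> bool" where
  "sym_pos_def M \<longleftrightarrow> transpose M = M \<and> (\<forall>x. x \<noteq> 0 \<longrightarrow> 0 < x \<bullet> (M *v x))"

definition stabilizable :: "real^'n^'n \<Rightarrow> real^'m^'n \<Rightarrow> bool" where
  "stabilizable A B \<longleftrightarrow> (\<exists>F :: real^'n^'m. spectral_radius (A - B ** F) < 1)"

definition control :: "real^'n^'m \<Rightarrow> real^'n \<Rightarrow> real^'m" where
  "control K x = - (K *v x)"

primrec state :: "real^'n^'n \<Rightarrow> real^'m^'n \<Rightarrow> real^'n^'m \<Rightarrow> real^'n \<Rightarrow> nat \<Rightarrow> real^'n" where
  "state A B K x0 0 = x0"
| "state A B K x0 (Suc t) = A *v state A B K x0 t + B *v control K (state A B K x0 t)"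

definition stage_cost :: "real^'n^'n \<Rightarrow> real^'m^'m \<Rightarrow> real^'n \<Rightarrow> real^'m \<Rightarrow> real" where
  "stage_cost Q R x u = x \<bullet> (Q *v x) + u \<bullet> (R *v u)"

(* The summands are nonnegative for positive definite Q, R and a nonnegative discount factor,
   which is the only case in which this definition is meaningful: ennreal truncates
   negative reals to 0. *)
definition lqr_cost ::
  "(real^'n) measure \<Rightarrow> real^'n^'n \<Rightarrow> real^'m^'n \<Rightarrow> real^'n^'n \<Rightarrow> real^'m^'m \<Rightarrow>
    real \<Rightarrow> real^'n^'m \<Rightarrow> ennreal" where
  "lqr_cost D A B Q R \<gamma> K =
    (\<integral>\<^sup>+ x0. (\<Sum>t. ennreal (\<gamma> ^ t *
        stage_cost Q R (state A B K x0 t) (control K (state A B K x0 t)))) \<partial>D)"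

definition initial_distribution :: "(real^'n) measure \<Rightarrow> real \<Rightarrow> bool" where
  "initial_distribution D d \<longleftrightarrow>
    prob_space D \<and> sets D = sets borel \<and>
    (AE x in D. norm x \<le> d) \<and>
    (\<integral>x. x \<partial>D) = 0 \<and>
    (\<integral>x. (\<chi> i j. x $ i * x $ j) \<partial>D) = (mat 1 :: real^'n^'n)"

(* The upper bound (1 + s / (J - s)) * g on the new discount factor, with
   s the minimal eigenvalue of Q + K^T R K and J the cost for the discount factor g.
   In ereal the bound is infinite when s > 0 and J = s.
   For a one-dimensional state and a = A - B K nonzero the bound equals 1 / a^2; for that discount
   factor all summands of the cost are equal and positive, so the cost is infinite. Hence, in
   dimension one only, the bound itself is not admissible. *)
definition discount_bound ::
  "(real^'n) measure \<Rightarrow> real^'n^'n \<Rightarrow> real^'m^'n \<Rightarrow> real^'n^'n \<Rightarrow> real^'m^'m \<Rightarrow>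
    real \<Rightarrow> real^'n^'m \<Rightarrow> ereal" where
  "discount_bound D A B Q R \<gamma> K =
    (let s = ereal (min_eigenvalue (Q + transpose K ** R ** K));
         J = enn2ereal (lqr_cost D A B Q R \<gamma> K)
     in (1 + s / (J - s)) * ereal \<gamma>)"

end

theory Submission
  imports Defs "HOL-Computational_Algebra.Fundamental_Theorem_Algebra"
begin

text \<open>Write \<open>M = A - B K\<close>, \<open>S = Q + K\<^sup>T R K\<close>, let \<open>s\<close> be the least eigenvalue of \<open>S\<close>,
  \<open>V x = (\<Sum>t. \<gamma>\<^sup>t x\<^sub>t\<^sup>T S x\<^sub>t)\<close> and \<open>J = J\<^sub>\<gamma>(K)\<close>. The spectral radius assumption makes \<open>V\<close> finite.
  As the covariance is the identity, \<open>J\<close> is the sum of \<open>V\<close> over any orthonormal basis; choosing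
  a basis that contains \<open>x / \<bar>x\<bar>\<close> and using \<open>V \<ge> s\<close> on the other basis vectors gives
  \<open>V x \<le> \<kappa> \<bar>x\<bar>\<^sup>2\<close> with \<open>\<kappa> = J - (n - 1) s\<close>. Hence
  \<open>\<gamma> V (M x) = V x - x\<^sup>T S x \<le> (1 - s / \<kappa>) V x\<close>, and the bound on \<open>\<gamma>'\<close> makes
  \<open>q = (\<gamma>' / \<gamma>) (1 - s / \<kappa>) < 1\<close>, so the cost for \<open>\<gamma>'\<close> is dominated by the geometric series
  \<open>(\<Sum>t. q\<^sup>t V x)\<close>, which is uniformly bounded on the bounded support.\<close>

subsection \<open>Decay of matrix powers from the spectral radius\<close>

text \<open>This is the vector \<open>p(M) v\<close>, evaluated by Horner's rule on the
  coefficients, so that no matrix polynomial has to be formed.\<close>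

definition poly_mv :: "'a::field^'n^'n \<Rightarrow> 'a poly \<Rightarrow> 'a^'n \<Rightarrow> 'a^'n" where
  "poly_mv M p v = fold_coeffs (\<lambda>a w. a *s v + M *v w) p 0"

lemma poly_mv_0 [simp]: "poly_mv M 0 v = 0"
  by (simp add: poly_mv_def)

lemma poly_mv_pCons [simp]: "poly_mv M (pCons a p) v = a *s v + M *v poly_mv M p v"
  by (cases "p = 0 \<and> a = 0") (auto simp: poly_mv_def)

lemma poly_mv_add: "poly_mv M (p + q) v = poly_mv M p v + poly_mv M q v"
  by (induction p q rule: poly_induct2)
     (simp_all add: vector_sadd_rdistrib matrix_vector_right_distrib algebra_simps)

lemma poly_mv_smult: "poly_mv M (smult c p) v = c *s poly_mv M p v"
  by (induction p) (simp_all add: vector_smult_assoc vector_add_ldistrib vector_scalar_commute)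

lemma poly_mv_mult: "poly_mv M (p * q) v = poly_mv M p (poly_mv M q v)"
  by (induction p) (simp_all add: poly_mv_add poly_mv_smult)

lemma poly_mv_sum: "poly_mv M (sum f S) v = (\<Sum>i\<in>S. poly_mv M (f i) v)"
  by (induction S rule: infinite_finite_induct) (simp_all add: poly_mv_add)

lemma poly_mv_monom: "poly_mv M (monom c i) v = c *s (((*v) M ^^ i) v)"
  by (induction i) (simp_all add: monom_0 monom_Suc vector_scalar_commute)

lemma poly_mv_eigenvector:
  assumes "M *v v = c *s v"
  shows "poly_mv M p v = poly p c *s v"
  by (induction p)
     (simp_all add: vector_scalar_commute assms vector_smult_assoc vector_sadd_rdistrib mult.commute)

text \<open>The space of matrices has finite real dimension, so sufficiently many powers of
  \<open>M\<close> satisfy a linear relation, whose coefficients form \<open>p\<close>.\<close>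

lemma matrix_annihilating_poly:
  fixes M :: "'a::{real_normed_field,euclidean_space}^'n^'n"
  obtains p where "p \<noteq> 0" "\<And>v. poly_mv M p v = 0"
proof -
  define X where "X i = (((**) M) ^^ i) (mat 1)" for i
  have X: "X i *v v = ((*v) M ^^ i) v" for i v
    by (induction i) (simp_all add: X_def flip: matrix_vector_mul_assoc)
  show thesis
  \<comment> \<open>Dependence concerns the set of powers and does not see repetitions, so two
    coinciding powers are treated separately, with \<open>p\<close> the difference of two
    monomials.\<close>
  proof (cases "inj_on X {..DIM('a^'n^'n)}")
    case False
    then obtain i j where ij: "i \<noteq> j" "X i = X j"
      by (auto simp: inj_on_def)
    define p :: "'a poly" where "p = monom 1 i + monom (-1) j"
    have "coeff p i = 1"
      using ij by (simp add: p_def)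
    then have "p \<noteq> 0"
      by auto
    moreover have "poly_mv M p v = 0" for v
      using ij by (simp add: p_def poly_mv_add poly_mv_monom flip: X)
    ultimately show thesis
      by (rule that)
  next
    case True
    then have "dependent (X ` {..DIM('a^'n^'n)})"
      by (intro dependent_biggerset) (simp add: card_image)
    then obtain u i0 where u: "(\<Sum>Y\<in>X ` {..DIM('a^'n^'n)}. u Y *\<^sub>R Y) = 0"
      and i0: "i0 \<le> DIM('a^'n^'n)" "u (X i0) \<noteq> 0"
      by (auto simp: dependent_finite)
    have u': "(\<Sum>i\<le>DIM('a^'n^'n). u (X i) *\<^sub>R X i) = 0"
      using u True by (simp add: sum.reindex)
    define p where "p = (\<Sum>i\<le>DIM('a^'n^'n). monom (of_real (u (X i)) :: 'a) i)"
    have "coeff p i0 = of_real (u (X i0))"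
      using i0 by (simp add: p_def coeff_sum)
    then have "p \<noteq> 0"
      using i0 by auto
    moreover have "poly_mv M p v = 0" for v
    proof -
      have "poly_mv M p v = (\<Sum>i\<le>DIM('a^'n^'n). of_real (u (X i)) *s (X i *v v))"
        by (simp add: p_def poly_mv_sum poly_mv_monom X)
      also have "\<dots> = (\<Sum>i\<le>DIM('a^'n^'n). u (X i) *\<^sub>R X i) *v v"
        by (simp add: vec_eq_iff matrix_vector_mult_def sum_distrib_right sum_distrib_left
              sum.swap[of _ "UNIV :: 'n set"] flip: scaleR_conv_of_real)
      finally show ?thesis
        unfolding u' by simp
    qed
    ultimately show thesis
      by (rule that)
  qed
qed

text \<open>Every eigenvalue is a root of an annihilating polynomial. Finiteness is what gives
  \<open>Max\<close> and \<open>Min\<close> over eigenvalues their intended meaning.\<close>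

lemma finite_eigenvalues:
  fixes M :: "'a::{real_normed_field,euclidean_space}^'n^'n"
  shows "finite (eigenvalues M)"
proof -
  obtain p where p: "p \<noteq> 0" "\<And>v. poly_mv M p v = 0"
    by (rule matrix_annihilating_poly[of M]) blast
  have "poly p c = 0" if c: "c \<in> eigenvalues M" for c
  proof -
    obtain v where "v \<noteq> 0" "M *v v = c *s v"
      using c by (auto simp: eigenvalues_def)
    then show ?thesis
      using p(2)[of v] by (simp add: poly_mv_eigenvector)
  qed
  then show ?thesis
    by (intro finite_subset[OF _ poly_roots_finite[OF p(1)]]) auto
qed

text \<open>The strict gap \<open>q < r\<close> lets the forcing term be absorbed into the constant,
  without a polynomial factor in \<open>t\<close>.\<close>

lemma geometric_recursion_bound:
  fixes a :: "nat \<Rightarrow> real"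
  assumes rec: "\<And>t. a (Suc t) \<le> q * a t + C * r ^ t" and "0 \<le> q" "q < r" "0 \<le> C"
  shows "\<exists>C'\<ge>0. \<forall>t. a t \<le> C' * r ^ t"
proof -
  \<comment> \<open>The first entry starts the induction; the second gives
    \<open>q * C' + C \<le> r * C'\<close>, the induction step.\<close>
  define C' where "C' = max (a 0) (C / (r - q))"
  have "C \<le> C' * (r - q)"
    using assms by (simp add: C'_def flip: pos_divide_le_eq)
  have "0 \<le> C'"
    using assms by (simp add: C'_def le_max_iff_disj)
  moreover have "a t \<le> C' * r ^ t" for t
  proof (induction t)
    case 0
    then show ?case by (simp add: C'_def)
  next
    case (Suc t)
    have "a (Suc t) \<le> q * (C' * r ^ t) + C * r ^ t"
      using rec[of t] mult_left_mono[OF Suc \<open>0 \<le> q\<close>] by linarith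
    also have "\<dots> = (q * C' + C) * r ^ t"
      by (simp add: algebra_simps)
    also have "\<dots> \<le> (r * C') * r ^ t"
      using \<open>C \<le> C' * (r - q)\<close> assms by (intro mult_right_mono) (simp_all add: algebra_simps)
    finally show ?case
      by (simp add: mult_ac)
  qed
  ultimately show ?thesis by blast
qed

lemma mat_vec_funpow_diff:
  "((*v) M ^^ t) (x - y) = ((*v) M ^^ t) x - ((*v) (M :: 'a::comm_ring_1^'n^'n) ^^ t) y"
  by (induction t) (simp_all add: matrix_vector_mult_diff_distrib)

lemma mat_vec_funpow_scale:
  "((*v) M ^^ t) (c *s x) = c *s ((*v) (M :: 'a::field^'n^'n) ^^ t) x"
  by (induction t) (simp_all add: vector_scalar_commute)

lemma norm_vector_scalar_mult: "norm (c *s (x :: complex^'n)) = cmod c * norm x"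
  by (simp add: norm_vec_def norm_mult L2_set_right_distrib)

text \<open>Peel off one root \<open>c\<close> of the annihilating polynomial at a time: if \<open>c\<close> is no eigenvalue the
  factor is injective and can be dropped; otherwise \<open>w = M v - c v\<close> decays by induction and
  \<open>M\<^sup>t v\<close> satisfies a scalar recursion with forcing term \<open>M\<^sup>t w\<close>.\<close>

lemma complex_power_decay:
  fixes M :: "complex^'n^'n"
  assumes "0 \<le> s" "0 < r"
    and eig: "\<And>c. c \<in> eigenvalues M \<Longrightarrow> s * cmod c < r"
    and "p \<noteq> 0" "poly_mv M p v = 0"
  shows "\<exists>C\<ge>0. \<forall>t. s ^ t * norm (((*v) M ^^ t) v) \<le> C * r ^ t"
  using assms(4-)
proof (induction "degree p" arbitrary: p v rule: less_induct)
  case less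
  show ?case
  proof (cases "degree p = 0")
    case True
    then obtain c where "p = [:c:]"
      by (rule degree_eq_zeroE)
    with less.prems have "v = 0"
      by simp
    have "((*v) M ^^ t) 0 = 0" for t
      by (induction t) simp_all
    then show ?thesis
      using \<open>v = 0\<close> by (intro exI[of _ 0]) simp
  next
    case False
    then obtain c where c: "poly p c = 0"
      using fundamental_theorem_of_algebra[of p] by (auto simp: constant_degree)
    then obtain q where q: "p = [:-c, 1:] * q"
      by (auto simp: poly_eq_0_iff_dvd)
    have "q \<noteq> 0"
      using less.prems(1) q by auto
    then have deg: "degree q < degree p"
      by (subst q, subst degree_mult_eq) auto
    have lin: "poly_mv M [:-c, 1:] w = M *v w - c *s w" for w
      by (simp add: vector_sneg_minus1[of w] vector_smult_assoc)
    show ?thesis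
    proof (cases "c \<in> eigenvalues M")
      case False
      \<comment> \<open>A nonzero \<open>poly_mv M q v\<close> would be an eigenvector for
        \<open>c\<close>.\<close>
      have "M *v poly_mv M q v - c *s poly_mv M q v = 0"
        using less.prems(2) unfolding q poly_mv_mult lin .
      then have "poly_mv M q v = 0"
        using False by (auto simp: eigenvalues_def)
      then show ?thesis
        using less.hyps[OF deg] \<open>q \<noteq> 0\<close> by blast
    next
      case True
      define w where "w = M *v v - c *s v"
      \<comment> \<open>The factors commute; letting the linear one act first shows that
        \<open>q\<close> annihilates \<open>w\<close>.\<close>
      have "poly_mv M (q * [:-c, 1:]) v = 0"
        using less.prems(2) q by (simp only: mult.commute)
      then have "poly_mv M q w = 0"
        unfolding poly_mv_mult lin w_def .
      then obtain C where C: "0 \<le> C" "\<And>t. s ^ t * norm (((*v) M ^^ t) w) \<le> C * r ^ t"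
        using less.hyps[OF deg] \<open>q \<noteq> 0\<close> by blast
      have "s ^ Suc t * norm (((*v) M ^^ Suc t) v)
          \<le> (s * cmod c) * (s ^ t * norm (((*v) M ^^ t) v)) + (s * C) * r ^ t" for t
      proof -
        have "((*v) M ^^ Suc t) v = ((*v) M ^^ t) (c *s v + w)"
          by (simp add: w_def funpow_swap1)
        also have "\<dots> = c *s ((*v) M ^^ t) v + ((*v) M ^^ t) w"
          using mat_vec_funpow_diff[where x = "c *s v + w" and y = "c *s v"]
          by (simp add: mat_vec_funpow_scale algebra_simps)
        finally have "norm (((*v) M ^^ Suc t) v)
            \<le> cmod c * norm (((*v) M ^^ t) v) + norm (((*v) M ^^ t) w)"
          using norm_triangle_ineq by (metis norm_vector_scalar_mult)
        then have "s ^ Suc t * norm (((*v) M ^^ Suc t) v)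
            \<le> s ^ Suc t * (cmod c * norm (((*v) M ^^ t) v) + norm (((*v) M ^^ t) w))"
          using \<open>0 \<le> s\<close> by (intro mult_left_mono) simp_all
        also have "\<dots> = (s * cmod c) * (s ^ t * norm (((*v) M ^^ t) v))
            + s * (s ^ t * norm (((*v) M ^^ t) w))"
          by (simp add: algebra_simps)
        also have "\<dots> \<le> (s * cmod c) * (s ^ t * norm (((*v) M ^^ t) v)) + s * (C * r ^ t)"
          using C(2)[of t] \<open>0 \<le> s\<close> by (intro add_left_mono mult_left_mono)
        finally show ?thesis
          by (simp add: mult.assoc)
      qed
      then show ?thesis
        using \<open>0 \<le> s\<close> C(1) eig[OF True] by (intro geometric_recursion_bound[where q = "s * cmod c" and C = "s * C"]) auto
    qed
  qed
qed

text \<open>Transfers the complex estimate along the isometric embedding \<open>emb\<close>. The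
  rate \<open>r\<close> is uniform, while \<open>C\<close> may depend on \<open>x\<close>; pointwise
  summability needs no more.\<close>

lemma spectral_radius_decay:
  fixes M :: "real^'n^'n"
  assumes "0 \<le> s" "s * spectral_radius M < 1"
  obtains r where "0 < r" "r < 1"
    "\<And>x. \<exists>C\<ge>0. \<forall>t. s ^ t * norm (((*v) M ^^ t) x) \<le> C * r ^ t"
proof
  \<comment> \<open>A midpoint, strictly between \<open>s * spectral_radius M\<close> and 1; the
    maximum with 0 secures positivity.\<close>
  define r where "r = (1 + max 0 (s * spectral_radius M)) / 2"
  show r: "0 < r" "r < 1"
    using assms by (auto simp: r_def)
  define N :: "complex^'n^'n" where "N = (\<chi> i j. complex_of_real (M $ i $ j))"
  define emb :: "real^'n \<Rightarrow> complex^'n" where "emb x = (\<chi> i. complex_of_real (x $ i))" for x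
  obtain p where p: "p \<noteq> 0" "\<And>v. poly_mv N p v = 0"
    by (rule matrix_annihilating_poly[of N]) blast
  have eig: "s * cmod c < r" if "c \<in> eigenvalues N" for c
  proof -
    have "cmod c \<le> spectral_radius M"
      unfolding spectral_radius_def N_def[symmetric] using that
      by (intro Max_ge finite_imageI finite_eigenvalues imageI)
    then have "s * cmod c \<le> s * spectral_radius M"
      using assms by (intro mult_left_mono)
    then show ?thesis
      using assms(2) by (auto simp: r_def)
  qed
  have emb: "norm (emb x) = norm x" for x
    by (simp add: emb_def norm_vec_def)
  have "emb (M *v x) = N *v emb x" for x
    by (simp add: emb_def N_def matrix_vector_mult_def vec_eq_iff)
  then have "((*v) N ^^ t) (emb x) = emb (((*v) M ^^ t) x)" for t x
    by (induction t) simp_all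
  then show "\<exists>C\<ge>0. \<forall>t. s ^ t * norm (((*v) M ^^ t) x) \<le> C * r ^ t" for x
    using complex_power_decay[OF assms(1) r(1) eig p(1) p(2), of "emb x"] by (simp add: emb)
qed

subsection \<open>Least eigenvalue and second moments\<close>

lemma symmetric_matrix_inner:
  fixes S :: "real^'n^'n"
  assumes "transpose S = S"
  shows "x \<bullet> (S *v y) = y \<bullet> (S *v x)"
proof -
  have "x \<bullet> (S *v y) = (transpose S *v x) \<bullet> y"
    by (simp only: transpose_matrix_vector dot_lmul_matrix)
  also have "\<dots> = y \<bullet> (S *v x)"
    unfolding assms by (rule inner_commute)
  finally show ?thesis .
qed

text \<open>A minimiser \<open>v\<close> of the quadratic form on the unit sphere is an eigenvector:
  the nonnegative form \<open>g\<close> vanishes at \<open>v\<close>, hence so does its first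
  variation there.\<close>

lemma rayleigh_minimum:
  fixes S :: "real^'n^'n"
  assumes sym: "transpose S = S"
  shows "\<exists>c\<in>eigenvalues S. \<forall>x. c * (x \<bullet> x) \<le> x \<bullet> (S *v x)"
proof -
  let ?f = "\<lambda>x. x \<bullet> (S *v x)"
  have "sphere (0 :: real^'n) 1 \<noteq> {}"
    using vector_choose_size[of 1] by fastforce
  moreover have "continuous_on (sphere 0 1) ?f"
    by (intro continuous_intros)
  ultimately have "\<exists>v\<in>sphere 0 1. \<forall>y\<in>sphere 0 1. ?f v \<le> ?f y"
    by (intro continuous_attains_inf compact_sphere)
  then obtain v where v: "norm v = 1" and min: "\<And>y. norm y = 1 \<Longrightarrow> ?f v \<le> ?f y"
    by auto
  define c where "c = ?f v"
  define g where "g x = ?f x - c * (x \<bullet> x)" for x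
  have g_nonneg: "0 \<le> g x" for x
  proof (cases "x = 0")
    case False
    have "c \<le> ?f (x /\<^sub>R norm x)"
      unfolding c_def using False by (intro min) simp
    also have "\<dots> = ?f x / (x \<bullet> x)"
      by (simp add: matrix_vector_mult_scaleR field_simps power2_norm_eq_inner[symmetric] power2_eq_square)
    finally show ?thesis
      using False by (simp add: g_def field_simps)
  qed (simp add: g_def)
  have "v \<bullet> v = 1"
    using v by (simp add: norm_eq_1)
  \<comment> \<open>The eigenvector residual. Moving from \<open>v\<close> in this direction changes
    \<open>g\<close> at first order by \<open>2 * t * (w \<bullet> w)\<close>, which must
    vanish.\<close>
  define w where "w = S *v v - c *\<^sub>R v"
  have expand: "g (v + t *\<^sub>R w) = 2 * t * (w \<bullet> w) + t\<^sup>2 * g w" for t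
  proof -
    have "v \<bullet> (S *v w) = w \<bullet> (S *v v)"
      by (rule symmetric_matrix_inner[OF sym])
    moreover have "w \<bullet> (S *v v) = w \<bullet> w + c * (w \<bullet> v)"
      by (simp add: w_def inner_diff_right)
    moreover have "v \<bullet> (S *v v) = c" by (simp add: c_def)
    ultimately show ?thesis
      using \<open>v \<bullet> v = 1\<close>
      by (simp add: g_def matrix_vector_right_distrib matrix_vector_mult_scaleR inner_add_left
            inner_add_right inner_commute[of v w] power2_eq_square algebra_simps)
  qed
  have "w \<bullet> w = 0"
  proof (rule ccontr)
    assume "w \<bullet> w \<noteq> 0"
    then have pos: "0 < w \<bullet> w" by (simp add: order_less_le)
    \<comment> \<open>A negative step short enough for the linear term to dominate; the added 1
      keeps the denominator positive.\<close>
    define t where "t = - (w \<bullet> w) / (1 + g w)"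
    have "t * (1 + g w) = - (w \<bullet> w)"
      using g_nonneg[of w] by (simp add: t_def)
    then have "g (v + t *\<^sub>R w) = t * (w \<bullet> w) - t\<^sup>2"
      unfolding expand by (simp add: power2_eq_square) algebra
    moreover have "t < 0"
      using pos g_nonneg[of w] by (simp add: t_def field_simps)
    ultimately have "g (v + t *\<^sub>R w) < 0"
      using pos by (smt (verit) mult_neg_pos zero_le_power2)
    then show False
      using g_nonneg[of "v + t *\<^sub>R w"] by simp
  qed
  then have "S *v v = c *s v"
    by (simp add: w_def scalar_mult_eq_scaleR)
  then have "c \<in> eigenvalues S"
    using \<open>v \<bullet> v = 1\<close> by (auto simp: eigenvalues_def intro!: exI[of _ v])
  moreover have "c * (x \<bullet> x) \<le> x \<bullet> (S *v x)" for x
    using g_nonneg[of x] by (simp add: g_def)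
  ultimately show ?thesis
    by blast
qed

lemma min_eigenvalue_mem:
  fixes S :: "real^'n^'n"
  assumes "transpose S = S"
  shows "min_eigenvalue S \<in> eigenvalues S"
proof -
  have "eigenvalues S \<noteq> {}"
    using rayleigh_minimum[OF assms] by blast
  then show ?thesis
    unfolding min_eigenvalue_def by (intro Min_in finite_eigenvalues)
qed

lemma min_eigenvalue_le_quadratic_form:
  fixes S :: "real^'n^'n"
  assumes "transpose S = S"
  shows "min_eigenvalue S * (x \<bullet> x) \<le> x \<bullet> (S *v x)"
proof -
  obtain c where c: "c \<in> eigenvalues S" "\<forall>x. c * (x \<bullet> x) \<le> x \<bullet> (S *v x)"
    using rayleigh_minimum[OF assms] by (rule bexE)
  have "min_eigenvalue S \<le> c"
    unfolding min_eigenvalue_def by (intro Min_le finite_eigenvalues c)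
  then have "min_eigenvalue S * (x \<bullet> x) \<le> c * (x \<bullet> x)"
    by (rule mult_right_mono) simp
  moreover have "c * (x \<bullet> x) \<le> x \<bullet> (S *v x)"
    using c(2) by (rule spec)
  ultimately show ?thesis by linarith
qed

lemma min_eigenvalue_pos:
  assumes "sym_pos_def S"
  shows "0 < min_eigenvalue S"
proof -
  obtain v where "v \<noteq> 0" "S *v v = min_eigenvalue S *s v"
    using min_eigenvalue_mem[of S] assms unfolding sym_pos_def_def eigenvalues_def by blast
  moreover have "0 < v \<bullet> (S *v v)"
    using assms \<open>v \<noteq> 0\<close> by (simp add: sym_pos_def_def)
  ultimately have "0 < min_eigenvalue S * (v \<bullet> v)"
    by (simp add: scalar_mult_eq_scaleR)
  then show ?thesis
    by (rule zero_less_mult_pos2) (simp add: \<open>v \<noteq> 0\<close>)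
qed

text \<open>The product of two coordinates is a linear functional of the matrix of products, so its
  mean can be read off from the identity covariance.\<close>

lemma second_moments:
  assumes mom: "(\<integral>x. (\<chi> i j. x $ i * x $ j) \<partial>D) = (mat 1 :: real^'n^'n)"
  shows "has_bochner_integral D (\<lambda>x. (x \<bullet> a) * (x \<bullet> b)) (a \<bullet> (b :: real^'n))"
proof -
  let ?X = "\<lambda>x :: real^'n. (\<chi> i j. x $ i * x $ j) :: real^'n^'n"
  \<comment> \<open>A Bochner integral defaults to 0 for non-integrable functions, so the nonzero
    value \<open>mat 1\<close> forces integrability.\<close>
  have "(mat 1 :: real^'n^'n) $ i $ i \<noteq> 0 $ i $ i" for i
    by (simp add: mat_def)
  then have "(mat 1 :: real^'n^'n) \<noteq> 0"
    by metis
  then have "integrable D ?X"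
    using mom not_integrable_integral_eq[of D ?X] by argo
  then have X: "has_bochner_integral D ?X (mat 1)"
    using mom by (simp add: has_bochner_integral_iff)
  have "linear (\<lambda>X :: real^'n^'n. a \<bullet> (X *v b))"
    by (rule linearI)
       (simp_all add: matrix_vector_mult_add_rdistrib inner_add_right flip: scaleR_matrix_vector_assoc)
  then have "has_bochner_integral D (\<lambda>x. a \<bullet> (?X x *v b)) (a \<bullet> (mat 1 *v b))"
    by (intro has_bochner_integral_bounded_linear[OF _ X]) (simp add: linear_conv_bounded_linear)
  moreover have "a \<bullet> (?X x *v b) = (x \<bullet> a) * (x \<bullet> b)" for x
    by (simp add: inner_vec_def matrix_vector_mult_def sum_product)
       (simp add: sum_distrib_left mult_ac)
  ultimately show ?thesis
    by simp
qed

text \<open>The mean of a quadratic form is its trace. Leaving the orthonormal basis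
  \<open>E\<close> arbitrary allows it to be adapted to a given vector later.\<close>

lemma expected_quadratic_form:
  fixes h :: "real^'n \<Rightarrow> real^'n \<Rightarrow> real"
  assumes mom: "(\<integral>x. (\<chi> i j. x $ i * x $ j) \<partial>D) = (mat 1 :: real^'n^'n)"
    and bil: "bilinear h"
    and E: "pairwise orthogonal E" "\<And>e. e \<in> E \<Longrightarrow> norm e = 1" "span E = UNIV" "finite E"
  shows "has_bochner_integral D (\<lambda>x. h x x) (\<Sum>e\<in>E. h e e)"
proof -
  have lin: "linear (h x)" "linear (\<lambda>x. h x y)" for x y
    using bil by (auto simp: bilinear_def)
  have "h x x = (\<Sum>e\<in>E. \<Sum>e'\<in>E. ((x \<bullet> e) * (x \<bullet> e')) * h e e')" for x
  proof -
    have x: "(\<Sum>e\<in>E. (x \<bullet> e) *\<^sub>R e) = x"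
      using E by (intro orthonormal_basis_expand) auto
    have "h x x = h (\<Sum>e\<in>E. (x \<bullet> e) *\<^sub>R e) (\<Sum>e\<in>E. (x \<bullet> e) *\<^sub>R e)"
      unfolding x ..
    also have "\<dots> = (\<Sum>e\<in>E. \<Sum>e'\<in>E. ((x \<bullet> e) * (x \<bullet> e')) * h e e')"
      by (simp add: linear_sum[OF lin(1)] linear_sum[OF lin(2)] linear_cmul[OF lin(1)]
            linear_cmul[OF lin(2)] sum_distrib_left, subst sum.swap, simp add: mult_ac)
    finally show ?thesis .
  qed
  moreover have "has_bochner_integral D (\<lambda>x. \<Sum>e\<in>E. \<Sum>e'\<in>E. ((x \<bullet> e) * (x \<bullet> e')) * h e e')
      (\<Sum>e\<in>E. \<Sum>e'\<in>E. (e \<bullet> e') * h e e')"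
    by (intro has_bochner_integral_sum has_bochner_integral_mult_left second_moments[OF mom])
  moreover have "(\<Sum>e'\<in>E. (e \<bullet> e') * h e e') = h e e" if "e \<in> E" for e
  proof -
    have "e \<bullet> e = 1"
      using E(2)[OF that] by (simp add: norm_eq_1)
    moreover have "e \<bullet> e' = 0" if "e' \<in> E" "e' \<noteq> e" for e'
      using E(1) \<open>e \<in> E\<close> that by (auto simp: pairwise_def orthogonal_def)
    ultimately show ?thesis
      using that E(4) by (subst sum.remove[of _ e]) (auto intro: sum.neutral)
  qed
  ultimately show ?thesis
    by simp
qed

subsection \<open>Value function of the closed loop\<close>

definition closed_loop_cost ::
  "real \<Rightarrow> real^'n^'n \<Rightarrow> real^'n^'n \<Rightarrow> nat \<Rightarrow> real^'n \<Rightarrow> real" where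
  "closed_loop_cost \<gamma> M S t x = \<gamma> ^ t * (((*v) M ^^ t) x \<bullet> (S *v ((*v) M ^^ t) x))"

lemma state_eq_power: "state A B K x t = ((*v) (A - B ** K) ^^ t) x"
proof (induction t)
  case (Suc t)
  then show ?case
    by (simp add: control_def matrix_vector_mult_diff_rdistrib matrix_vector_mul_assoc
          linear_neg[OF matrix_vector_mul_linear])
qed simp

lemma quadratic_form_congruence:
  fixes K :: "real^'n^'m" and R :: "real^'m^'m"
  shows "x \<bullet> ((transpose K ** R ** K) *v y) = (K *v x) \<bullet> (R *v (K *v y))"
proof -
  have "x \<bullet> ((transpose K ** R ** K) *v y) = x \<bullet> (transpose K *v (R *v (K *v y)))"
    by (simp add: matrix_vector_mul_assoc matrix_mul_assoc)
  also have "\<dots> = (K *v x) \<bullet> (R *v (K *v y))"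
    by (subst (1 2) inner_commute) (simp add: transpose_matrix_vector dot_lmul_matrix)
  finally show ?thesis .
qed

text \<open>Inserting \<open>u = - K x\<close> folds the control penalty into the state weight; the
  sign cancels in the quadratic form.\<close>

lemma lqr_cost_closed_loop:
  "lqr_cost D A B Q R \<gamma> K =
    (\<integral>\<^sup>+x. (\<Sum>t. ennreal (closed_loop_cost \<gamma> (A - B ** K) (Q + transpose K ** R ** K) t x)) \<partial>D)"
  unfolding lqr_cost_def closed_loop_cost_def state_eq_power stage_cost_def
  by (simp add: control_def linear_neg[OF matrix_vector_mul_linear] matrix_vector_mult_add_rdistrib
        inner_add_right quadratic_form_congruence)

lemma sym_pos_def_closed_loop:
  fixes Q :: "real^'n^'n" and R :: "real^'m^'m" and K :: "real^'n^'m"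
  assumes "sym_pos_def Q" "sym_pos_def R"
  shows "sym_pos_def (Q + transpose K ** R ** K)"
proof -
  have "transpose (X + Y) = transpose X + transpose Y" for X Y :: "real^'n^'n"
    by (simp add: transpose_def vec_eq_iff)
  then have "transpose (Q + transpose K ** R ** K) = Q + transpose K ** R ** K"
    using assms by (simp add: sym_pos_def_def matrix_transpose_mul matrix_mul_assoc)
  moreover have "0 \<le> y \<bullet> (R *v y)" for y
    using assms(2) by (cases "y = 0") (auto simp: sym_pos_def_def intro: less_imp_le)
  ultimately show ?thesis
    using assms(1) by (auto simp: sym_pos_def_def matrix_vector_mult_add_rdistrib inner_add_right
          quadratic_form_congruence intro: add_pos_nonneg)
qed

text \<open>A quadratic form squares the decay of \<open>sqrt \<gamma> ^ t * norm (M^t x)\<close>,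
  so the summands are dominated by a geometric series of ratio \<open>r\<^sup>2\<close>.\<close>

lemma summable_closed_loop_cost:
  assumes "0 \<le> \<gamma>" "sqrt \<gamma> * spectral_radius M < 1"
  shows "summable (\<lambda>t. closed_loop_cost \<gamma> M S t x)"
proof -
  obtain r where r: "0 < r" "r < 1"
    and decay: "\<exists>C\<ge>0. \<forall>t. sqrt \<gamma> ^ t * norm (((*v) M ^^ t) x) \<le> C * r ^ t"
    using spectral_radius_decay[of "sqrt \<gamma>" M] assms by (metis real_sqrt_ge_zero)
  from decay obtain C where C: "0 \<le> C" "\<And>t. sqrt \<gamma> ^ t * norm (((*v) M ^^ t) x) \<le> C * r ^ t"
    by blast
  obtain k where k: "0 < k" "\<And>y. norm (S *v y) \<le> norm y * k"
    using bounded_linear.pos_bounded[OF matrix_vector_mul_bounded_linear[of S]] by blast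
  have bound: "norm (closed_loop_cost \<gamma> M S t x) \<le> (k * C\<^sup>2) * (r\<^sup>2) ^ t" for t
  proof -
    let ?y = "((*v) M ^^ t) x"
    have sq: "\<gamma> ^ t = (sqrt \<gamma> ^ t)\<^sup>2"
      using assms(1) by (simp add: power2_eq_square flip: power_mult_distrib)
    have "\<bar>?y \<bullet> (S *v ?y)\<bar> \<le> norm ?y * norm (S *v ?y)"
      by (rule Cauchy_Schwarz_ineq2)
    also have "\<dots> \<le> norm ?y * (norm ?y * k)"
      by (intro mult_left_mono k) simp
    finally have "norm (closed_loop_cost \<gamma> M S t x) \<le> \<gamma> ^ t * (norm ?y * (norm ?y * k))"
      using assms(1) by (simp add: closed_loop_cost_def abs_mult mult_left_mono)
    also have "\<dots> = k * (sqrt \<gamma> ^ t * norm ?y)\<^sup>2"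
      unfolding sq by (simp add: power2_eq_square mult_ac)
    also have "\<dots> \<le> k * (C * r ^ t)\<^sup>2"
      using C assms(1) k(1) by (intro mult_left_mono power_mono) simp_all
    finally show ?thesis
      by (simp add: power2_eq_square power_mult_distrib mult_ac)
  qed
  have "summable (\<lambda>t. (k * C\<^sup>2) * (r\<^sup>2) ^ t)"
    using r by (intro summable_mult summable_geometric) (simp add: power_less_one_iff)
  then show ?thesis
    by (rule summable_comparison_test'[where N = 0]) (rule bound)
qed

lemma closed_loop_cost_nonneg:
  assumes "0 \<le> \<gamma>" "\<And>y. 0 \<le> y \<bullet> (S *v y)"
  shows "0 \<le> closed_loop_cost \<gamma> M S t x"
  using assms by (simp add: closed_loop_cost_def)

lemma closed_loop_cost_Suc: "closed_loop_cost \<gamma> M S (Suc t) x = \<gamma> * closed_loop_cost \<gamma> M S t (M *v x)"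
  by (simp add: closed_loop_cost_def funpow_swap1)

lemma closed_loop_cost_scaleR: "closed_loop_cost \<gamma> M S t (a *\<^sub>R x) = a\<^sup>2 * closed_loop_cost \<gamma> M S t x"
  using mat_vec_funpow_scale[where M = M and c = a and x = x]
  by (simp add: closed_loop_cost_def scalar_mult_eq_scaleR matrix_vector_mult_scaleR power2_eq_square)

definition value_function :: "real \<Rightarrow> real^'n^'n \<Rightarrow> real^'n^'n \<Rightarrow> real^'n \<Rightarrow> real" where
  "value_function \<gamma> M S x = (\<Sum>t. closed_loop_cost \<gamma> M S t x)"

text \<open>The Bellman equation: the summand at time 0 is split off and the remaining sum restarts
  at \<open>M *v x\<close>.\<close>

lemma value_function_bellman:
  assumes "0 \<le> \<gamma>" "sqrt \<gamma> * spectral_radius M < 1"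
  shows "value_function \<gamma> M S x = x \<bullet> (S *v x) + \<gamma> * value_function \<gamma> M S (M *v x)"
  using suminf_split_head[OF summable_closed_loop_cost[OF assms, of S x]]
    suminf_mult[OF summable_closed_loop_cost[OF assms, of S "M *v x"], of \<gamma>]
  by (simp add: value_function_def closed_loop_cost_Suc) (simp add: closed_loop_cost_def)

lemma value_function_scaleR:
  assumes "0 \<le> \<gamma>" "sqrt \<gamma> * spectral_radius M < 1"
  shows "value_function \<gamma> M S (a *\<^sub>R x) = a\<^sup>2 * value_function \<gamma> M S x"
  by (simp add: value_function_def closed_loop_cost_scaleR suminf_mult summable_closed_loop_cost assms)

lemma value_function_nonneg:
  assumes "0 \<le> \<gamma>" "sqrt \<gamma> * spectral_radius M < 1" "\<And>y. 0 \<le> y \<bullet> (S *v y)"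
  shows "0 \<le> value_function \<gamma> M S x"
  unfolding value_function_def
  by (intro suminf_nonneg summable_closed_loop_cost closed_loop_cost_nonneg assms)

text \<open>The polarised form of \<open>closed_loop_cost\<close>, as required by
  \<open>expected_quadratic_form\<close>.\<close>

lemma bilinear_closed_loop:
  "bilinear (\<lambda>x y. \<gamma> ^ t * (((*v) M ^^ t) x \<bullet> (S *v ((*v) (M :: real^'n^'n) ^^ t) y)))"
proof -
  have lin: "linear ((*v) M ^^ t)"
  proof (induction t)
    case (Suc t)
    then show ?case
      using linear_compose[OF Suc matrix_vector_mul_linear] by (simp add: o_def)
  qed (simp add: linear_iff)
  show ?thesis
    unfolding bilinear_def
    by (auto intro!: linearI simp: linear_add[OF lin] linear_cmul[OF lin] matrix_vector_right_distrib
        matrix_vector_mult_scaleR inner_add_left inner_add_right algebra_simps)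
qed

text \<open>Nonnegativity permits exchanging sum and expectation; each summand then contributes its
  trace over \<open>E\<close>.\<close>

lemma expected_closed_loop_cost:
  fixes M S :: "real^'n^'n"
  assumes mom: "(\<integral>x. (\<chi> i j. x $ i * x $ j) \<partial>D) = (mat 1 :: real^'n^'n)"
    and \<gamma>: "0 \<le> \<gamma>" "sqrt \<gamma> * spectral_radius M < 1" and S: "\<And>y. 0 \<le> y \<bullet> (S *v y)"
    and E: "pairwise orthogonal E" "\<And>e. e \<in> E \<Longrightarrow> norm e = 1" "span E = UNIV" "finite E"
  shows "(\<integral>\<^sup>+x. (\<Sum>t. ennreal (closed_loop_cost \<gamma> M S t x)) \<partial>D)
    = ennreal (\<Sum>e\<in>E. value_function \<gamma> M S e)"
proof -
  let ?c = "closed_loop_cost \<gamma> M S"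
  note nonneg = closed_loop_cost_nonneg[OF \<gamma>(1) S]
  note summable = summable_closed_loop_cost[OF \<gamma>]
  have int: "has_bochner_integral D (?c t) (\<Sum>e\<in>E. ?c t e)" for t
    using expected_quadratic_form[OF mom bilinear_closed_loop E, of \<gamma> t M S]
    by (simp add: closed_loop_cost_def[abs_def])
  have "(\<integral>\<^sup>+x. (\<Sum>t. ennreal (?c t x)) \<partial>D) = (\<Sum>t. \<integral>\<^sup>+x. ennreal (?c t x) \<partial>D)"
    by (intro nn_integral_suminf measurable_compose[OF _ measurable_ennreal]
        borel_measurable_has_bochner_integral[OF int])
  also have "\<dots> = (\<Sum>t. ennreal (\<Sum>e\<in>E. ?c t e))"
    using int nonneg by (simp add: nn_integral_eq_integral has_bochner_integral_iff)
  also have "\<dots> = ennreal (\<Sum>t. \<Sum>e\<in>E. ?c t e)"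
    by (intro suminf_ennreal2 sum_nonneg nonneg summable_sum summable)
  also have "(\<Sum>t. \<Sum>e\<in>E. ?c t e) = (\<Sum>e\<in>E. value_function \<gamma> M S e)"
    unfolding value_function_def by (intro suminf_sum summable)
  finally show ?thesis .
qed

text \<open>Subtracting the share of the other basis vectors, rather than bounding by
  \<open>j\<close> alone, is what later admits equality in the discount bound for dimension at least
  2.\<close>

lemma value_function_le:
  fixes M S :: "real^'n^'n"
  assumes mom: "(\<integral>x. (\<chi> i j. x $ i * x $ j) \<partial>D) = (mat 1 :: real^'n^'n)"
    and \<gamma>: "0 \<le> \<gamma>" "sqrt \<gamma> * spectral_radius M < 1"
    and S: "\<And>y. s * (y \<bullet> y) \<le> y \<bullet> (S *v y)" "0 \<le> s"
    and j: "(\<integral>\<^sup>+x. (\<Sum>t. ennreal (closed_loop_cost \<gamma> M S t x)) \<partial>D) = ennreal j" "0 \<le> j"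
  shows "value_function \<gamma> M S x \<le> (j - (real CARD('n) - 1) * s) * (x \<bullet> x)"
proof (cases "x = 0")
  case True
  then show ?thesis
    using value_function_scaleR[OF \<gamma>, of S 0 0] by simp
next
  case False
  let ?V = "value_function \<gamma> M S"
  have S': "0 \<le> y \<bullet> (S *v y)" for y
    using S(1)[of y] mult_nonneg_nonneg[OF S(2) inner_ge_zero[of y]] by linarith
  have low: "s \<le> ?V e" if "norm e = 1" for e
    using S(1)[of e] value_function_bellman[OF \<gamma>, of S e] value_function_nonneg[OF \<gamma> S', of "M *v e"] \<gamma>(1) that
    by (simp add: norm_eq_1) (smt (verit) mult_nonneg_nonneg)
  define u where "u = x /\<^sub>R norm x"
  have "norm u = 1"
    using False by (simp add: u_def)
  \<comment> \<open>The trace does not depend on the basis, so the direction of \<open>x\<close> may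
    be one of its members.\<close>
  then obtain E where E: "u \<in> E" "pairwise orthogonal E" "\<And>e. e \<in> E \<Longrightarrow> norm e = 1"
    "independent E" "card E = CARD('n)" "span E = UNIV"
    using vector_in_orthonormal_basis by (metis DIM_cart DIM_real mult.right_neutral)
  have fin: "finite E"
    using E(4) by (rule finiteI_independent)
  have "ennreal j = ennreal (\<Sum>e\<in>E. ?V e)"
    using expected_closed_loop_cost[OF mom \<gamma> S' E(2,3,6) fin] j by simp
  then have "j = (\<Sum>e\<in>E. ?V e)"
    using j(2) value_function_nonneg[OF \<gamma> S'] by (simp add: sum_nonneg ennreal_inj)
  also have "\<dots> = ?V u + (\<Sum>e\<in>E - {u}. ?V e)"
    by (rule sum.remove[OF fin E(1)])
  finally have "j = ?V u + (\<Sum>e\<in>E - {u}. ?V e)" .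
  moreover have "(real CARD('n) - 1) * s \<le> (\<Sum>e\<in>E - {u}. ?V e)"
    using sum_bounded_below[of "E - {u}" s ?V] low E(1,3,5) fin by (simp add: of_nat_diff Suc_leI)
  ultimately have "?V u \<le> j - (real CARD('n) - 1) * s"
    by linarith
  then have "(x \<bullet> x) * ?V u \<le> (x \<bullet> x) * (j - (real CARD('n) - 1) * s)"
    by (intro mult_left_mono) simp_all
  moreover have "(x \<bullet> x) * ?V u = ?V x"
    using value_function_scaleR[OF \<gamma>, of S "norm x" u] False
    by (simp add: u_def dot_square_norm)
  ultimately show ?thesis
    by (simp add: mult.commute)
qed

section \<open>Contraction and finiteness for the new discount factor\<close>

text \<open>A Lyapunov argument with arbitrary \<open>V\<close>: it is applied with the new discount
  factor, while \<open>V\<close> remains the value function of the old one.\<close>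

lemma closed_loop_cost_contraction:
  assumes V: "\<And>x. x \<bullet> (S *v x) \<le> V x" and S: "\<And>x. 0 \<le> x \<bullet> (S *v x)"
    and contr: "\<And>x. \<gamma> * V (M *v x) \<le> q * V x"
    and "0 \<le> \<gamma>" "0 \<le> q" "q < 1"
  shows "(\<Sum>t. ennreal (closed_loop_cost \<gamma> M S t x)) \<le> ennreal (V x / (1 - q))"
proof -
  have V_nonneg: "0 \<le> V x" for x
    using V[of x] S[of x] by linarith
  have pow: "\<gamma> ^ t * V (((*v) M ^^ t) x) \<le> q ^ t * V x" for t
  proof (induction t)
    case (Suc t)
    have "\<gamma> ^ Suc t * V (((*v) M ^^ Suc t) x) = \<gamma> ^ t * (\<gamma> * V (M *v ((*v) M ^^ t) x))"
      by (simp add: mult_ac)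
    also have "\<dots> \<le> \<gamma> ^ t * (q * V (((*v) M ^^ t) x))"
      using \<open>0 \<le> \<gamma>\<close> by (intro mult_left_mono contr) simp
    also have "\<dots> = q * (\<gamma> ^ t * V (((*v) M ^^ t) x))"
      by (simp add: mult_ac)
    also have "\<dots> \<le> q * (q ^ t * V x)"
      using \<open>0 \<le> q\<close> by (intro mult_left_mono Suc.IH)
    finally show ?case
      by (simp add: mult_ac)
  qed simp
  have "closed_loop_cost \<gamma> M S t x \<le> q ^ t * V x" for t
    unfolding closed_loop_cost_def
    by (rule order_trans[OF mult_left_mono[OF V] pow]) (simp add: \<open>0 \<le> \<gamma>\<close>)
  then have "(\<Sum>t. ennreal (closed_loop_cost \<gamma> M S t x)) \<le> (\<Sum>t. ennreal (q ^ t * V x))"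
    by (intro suminf_le ennreal_leI) auto
  also have "\<dots> = ennreal (\<Sum>t. q ^ t * V x)"
    using assms(5,6) V_nonneg by (intro suminf_ennreal2 summable_mult2 summable_geometric) auto
  also have "(\<Sum>t. q ^ t * V x) = V x / (1 - q)"
    using assms(5,6) suminf_geometric[of q] by (simp flip: suminf_mult2)
  finally show ?thesis .
qed

text \<open>\<open>1 - s / \<kappa>\<close> is the decay rate of the value function along the closed loop. For \<open>n \<ge> 2\<close>
  equality in the bound on \<open>\<gamma>'\<close> is tolerated because the factor is then at most
  \<open>j (j - 2 s) / (j - s)\<^sup>2 < 1\<close>. For \<open>j = s\<close> the bound is infinite, but \<open>\<kappa> = s\<close> kills
  the factor.\<close>

lemma discount_contraction_factor:
  fixes s j \<kappa> \<gamma> \<gamma>' :: real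
  assumes "0 < s" "s \<le> \<kappa>" "\<kappa> = j - (real n - 1) * s" "0 < n" "0 < \<gamma>" "0 < \<gamma>'"
    and le: "j \<noteq> s \<Longrightarrow> \<gamma>' \<le> (1 + s / (j - s)) * \<gamma>"
    and less: "n = 1 \<Longrightarrow> j \<noteq> s \<Longrightarrow> \<gamma>' \<noteq> (1 + s / (j - s)) * \<gamma>"
  shows "\<gamma>' / \<gamma> * (1 - s / \<kappa>) < 1"
proof (cases "j = s")
  case True
  then have "(real n - 1) * s \<le> 0"
    using assms(2,3) by simp
  then have "\<kappa> = s"
    using assms(1-4) True by (auto simp: mult_le_0_iff)
  then show ?thesis
    using assms(1) by simp
next
  case False
  have "0 \<le> (real n - 1) * s"
    using assms(1,4) by simp
  then have "s < j"
    using False assms(2,3) by linarith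
  then have bound: "(1 + s / (j - s)) = j / (j - s)"
    by (simp add: field_simps)
  have "1 - s / \<kappa> \<ge> 0"
    using assms(1,2) by simp
  show ?thesis
  proof (cases "n = 1")
    case True
    then have "\<kappa> = j" using assms(3) by simp
    have "\<gamma>' / \<gamma> < j / (j - s)"
      using le less True False bound assms(5) by (simp add: pos_divide_less_eq)
    \<comment> \<open>The two factors on the right are reciprocal, so strictness has to come from
      the bound on \<open>\<gamma>'\<close>.\<close>
    then have "\<gamma>' / \<gamma> * (1 - s / j) < j / (j - s) * (1 - s / j)"
      using \<open>s < j\<close> assms(1) by (intro mult_strict_right_mono) simp_all
    also have "\<dots> = 1"
      using \<open>s < j\<close> assms(1) by (simp add: field_simps)
    finally show ?thesis
      using \<open>\<kappa> = j\<close> by simp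
  next
    case False
    \<comment> \<open>At least one further basis vector contributes \<open>s\<close>.\<close>
    then have "1 * s \<le> (real n - 1) * s"
      using assms(1,4) by (intro mult_right_mono) auto
    then have \<kappa>: "\<kappa> \<le> j - s"
      using assms(3) by linarith
    have "\<gamma>' / \<gamma> \<le> j / (j - s)"
      using le \<open>j \<noteq> s\<close> bound assms(5) by (simp add: pos_divide_le_eq)
    moreover have "1 - s / \<kappa> \<le> 1 - s / (j - s)"
      using \<kappa> assms(1,2) by (simp add: frac_le)
    ultimately have "\<gamma>' / \<gamma> * (1 - s / \<kappa>) \<le> j / (j - s) * (1 - s / (j - s))"
      using \<open>1 - s / \<kappa> \<ge> 0\<close> \<open>s < j\<close> assms(1) by (intro mult_mono) simp_all
    \<comment> \<open>With \<open>a = s / (j - s)\<close> the product is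
      \<open>(1 + a) * (1 - a)\<close>.\<close>
    also have "\<dots> = 1 - (s / (j - s))\<^sup>2"
      unfolding bound[symmetric] by (simp add: power2_eq_square algebra_simps)
    also have "\<dots> < 1"
      using \<open>s < j\<close> assms(1) by simp
    finally show ?thesis .
  qed
qed

text \<open>In dimension one \<open>\<kappa>\<close> equals \<open>j\<close>, and equality with a
  finite bound would make the contraction factor exactly 1; hence the separate exclusion of that
  case.\<close>

theorem theorem5:
  fixes A :: "real^'n^'n" and B :: "real^'m^'n"
    and Q :: "real^'n^'n" and R :: "real^'m^'m"
    and K :: "real^'n^'m"
    and D :: "(real^'n) measure"
    and d \<gamma> \<gamma>' :: real
  assumes "0 < d" and "initial_distribution D d"
    and "stabilizable A B"
    and "sym_pos_def Q" and "sym_pos_def R"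
    and "0 < \<gamma>" and "\<gamma> \<le> 1"
    and "sqrt \<gamma> * spectral_radius (A - B ** K) < 1"
    and "0 < \<gamma>'"
    and "ereal \<gamma>' \<le> discount_bound D A B Q R \<gamma> K"
    and "CARD('n) = 1 \<Longrightarrow> ereal \<gamma>' \<noteq> discount_bound D A B Q R \<gamma> K"
  shows "lqr_cost D A B Q R \<gamma>' K < \<infinity>"
proof -
  define M where "M = A - B ** K"
  define S where "S = Q + transpose K ** R ** K"
  define s where "s = min_eigenvalue S"
  let ?V = "value_function \<gamma> M S"
  interpret prob_space D
    using assms(2) by (simp add: initial_distribution_def)
  have mom: "(\<integral>x. (\<chi> i j. x $ i * x $ j) \<partial>D) = (mat 1 :: real^'n^'n)"
    and bnd: "AE x in D. norm x \<le> d"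
    using assms(2) by (simp_all add: initial_distribution_def)
  have \<gamma>: "0 \<le> \<gamma>" "sqrt \<gamma> * spectral_radius M < 1"
    using assms by (simp_all add: M_def)
  have spd: "sym_pos_def S"
    unfolding S_def by (intro sym_pos_def_closed_loop assms)
  then have s_pos: "0 < s"
    unfolding s_def by (rule min_eigenvalue_pos)
  have S: "s * (x \<bullet> x) \<le> x \<bullet> (S *v x)" for x
    unfolding s_def using spd by (intro min_eigenvalue_le_quadratic_form) (simp add: sym_pos_def_def)
  have S_nonneg: "0 \<le> x \<bullet> (S *v x)" for x
    using S[of x] mult_nonneg_nonneg[OF less_imp_le[OF s_pos] inner_ge_zero[of x]] by linarith
  note V_nonneg = value_function_nonneg[OF \<gamma> S_nonneg]
  have V_ge: "x \<bullet> (S *v x) \<le> ?V x" for x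
    using value_function_bellman[OF \<gamma>, of S x] V_nonneg[of "M *v x"] \<gamma>(1) by simp

  \<comment> \<open>The trace over the standard basis exhibits the cost for \<open>\<gamma>\<close>
    as a finite real number.\<close>
  define j where "j = (\<Sum>e\<in>Basis. ?V e)"
  have j: "lqr_cost D A B Q R \<gamma> K = ennreal j" "0 \<le> j"
    using expected_closed_loop_cost[OF mom \<gamma> S_nonneg, of Basis] V_nonneg
    by (auto simp: lqr_cost_closed_loop M_def S_def j_def sum_nonneg pairwise_def orthogonal_def
        inner_not_same_Basis)
  define \<kappa> where "\<kappa> = j - (real CARD('n) - 1) * s"
  have V_le: "?V x \<le> \<kappa> * (x \<bullet> x)" for x
    unfolding \<kappa>_def using j s_pos
    by (intro value_function_le[OF mom \<gamma> S]) (simp_all add: lqr_cost_closed_loop M_def S_def)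
  obtain u :: "real^'n" where "norm u = 1"
    using vector_choose_size[of 1] by auto
  then have "s \<le> \<kappa>"
    using S[of u] V_ge[of u] V_le[of u] by (simp add: norm_eq_1)

  \<comment> \<open>For \<open>j = s\<close> the two sides differ: division by zero gives infinity
    in \<open>ereal\<close> but 0 in the reals.\<close>
  have bound: "discount_bound D A B Q R \<gamma> K = ereal ((1 + s / (j - s)) * \<gamma>)" if "j \<noteq> s"
    using that j by (simp add: discount_bound_def Let_def enn2ereal_ennreal one_ereal_def flip: S_def s_def)
  define q where "q = \<gamma>' / \<gamma> * (1 - s / \<kappa>)"
  have "q < 1"
    unfolding q_def
    using assms(6,9,10,11) s_pos \<open>s \<le> \<kappa>\<close> bound
    by (intro discount_contraction_factor[where n = "CARD('n)" and j = j]) (auto simp: \<kappa>_def)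
  have "0 \<le> q"
    using assms(6,9) s_pos \<open>s \<le> \<kappa>\<close> by (simp add: q_def)
  have "\<gamma>' * ?V (M *v x) \<le> q * ?V x" for x
  proof -
    \<comment> \<open>The stage cost is at least the fraction \<open>s / \<kappa>\<close> of the
      value, and the Bellman equation removes it in one step.\<close>
    have "s / \<kappa> * ?V x \<le> s / \<kappa> * (\<kappa> * (x \<bullet> x))"
      using s_pos \<open>s \<le> \<kappa>\<close> by (intro mult_left_mono V_le) simp
    also have "\<dots> \<le> x \<bullet> (S *v x)"
      using s_pos \<open>s \<le> \<kappa>\<close> S[of x] by simp
    finally have "\<gamma> * ?V (M *v x) \<le> (1 - s / \<kappa>) * ?V x"
      using value_function_bellman[OF \<gamma>, of S x] by (simp add: algebra_simps)
    then have "\<gamma>' / \<gamma> * (\<gamma> * ?V (M *v x)) \<le> \<gamma>' / \<gamma> * ((1 - s / \<kappa>) * ?V x)"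
      using assms(6,9) by (intro mult_left_mono) simp_all
    then show ?thesis
      using assms(6) by (simp add: q_def)
  qed
  then have cost: "(\<Sum>t. ennreal (closed_loop_cost \<gamma>' M S t x)) \<le> ennreal (?V x / (1 - q))" for x
    using assms(9) \<open>0 \<le> q\<close> \<open>q < 1\<close> V_ge S_nonneg by (intro closed_loop_cost_contraction) auto
  \<comment> \<open>On the bounded support the pointwise estimate becomes a constant, which is
    integrable for a probability measure.\<close>
  have "(\<Sum>t. ennreal (closed_loop_cost \<gamma>' M S t x)) \<le> ennreal (\<kappa> * d\<^sup>2 / (1 - q))"
    if "norm x \<le> d" for x
  proof -
    have "x \<bullet> x \<le> d\<^sup>2"
      using that by (simp add: power_mono flip: power2_norm_eq_inner)
    then have "\<kappa> * (x \<bullet> x) \<le> \<kappa> * d\<^sup>2"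
      using s_pos \<open>s \<le> \<kappa>\<close> by (intro mult_left_mono) simp_all
    then have "?V x / (1 - q) \<le> \<kappa> * d\<^sup>2 / (1 - q)"
      using V_le[of x] \<open>q < 1\<close> by (intro divide_right_mono) simp_all
    then show ?thesis
      using cost[of x] by (meson ennreal_leI order_trans)
  qed
  then have "lqr_cost D A B Q R \<gamma>' K \<le> (\<integral>\<^sup>+x. ennreal (\<kappa> * d\<^sup>2 / (1 - q)) \<partial>D)"
    unfolding lqr_cost_closed_loop M_def[symmetric] S_def[symmetric]
    using bnd by (intro nn_integral_mono_AE) auto
  also have "\<dots> < \<infinity>"
    by (simp add: emeasure_space_1)
  finally show ?thesis .
qed

end
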